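(* Let $d\ge 1$ and let $\rho\subseteq A^{B^d}$ be an R-relation of simple arity $\alpha=B^d$. The following are equivalent: (a) $\rho^{\leftrightarrow}$ is a minion; (b) $\rho$ is a weak generalized quasiorder.
   Context: $A$ and $B$ are finite nonempty sets; $\mathbb N=\{0,1,2,\dots\}$. An R-relation of simple arity $B^d$ is a set $\rho\subseteq A^{B^d}$ of functions $B^d\to A$. For $h:B^{n+1}\to A$, $\mathrm{ebtrl}(h)$ is the set of all functions $(x_0,\dots,x_{n-1})\mapsto h(x_0,\dots,x_{i-1},c,x_i,\dots,x_{n-1})$ with $0\le i\le n$, $c\in B$; for nullary $h$, $\mathrm{ebtrl}(h)=\emptyset$. For $g:B^n\to A$, $\mathrm{eftrl}(g)$ consists of the two functions $(x_0,\dots,x_n)\mapsto g(x_1,\dots,x_n)$ and $(x_0,\dots,x_n)\mapsto g(x_0,\dots,x_{n-1})$. For $\rho\subseteq A^{B^n}$, $\circledast(\rho):=\{h\in A^{B^{n+1}}\mid\mathrm{ebtrl}(h)\subseteq\rho\}\subseteq A^{B^{n+1}}$. For $h\in A^{B^{n+1}}$, $\mathbf\Delta(h)$ is the set of all functions $(x_0,\dots,x_{n-1})\mapsto h(x_0,\dots,x_{j-1},x_i,x_j,\dots,x_{n-1})$ with $0\le i<j\le n$. The operators $\mathrm{ebtrl},\mathrm{eftrl},\mathbf\Delta$ are extended to sets by unions, and superscripts denote iteration (0-th power is the identity). $\rho\subseteq A^{B^d}$ is internally reflexive if $\mathrm{eftrl}(\rho)\subseteq\circledast(\rho)$, transitive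 if $\mathbf\Delta(\circledast(\rho))\subseteq\rho$, and a weak generalized quasiorder if it is both. For $\rho\subseteq A^{B^d}$ put $\rho_n:=\circledast^{n-d}(\rho)$ if $n>d$ and $\rho_n:=\mathrm{ebtrl}^{d-n}(\rho)$ if $n\le d$, for $n\in\mathbb N$; so $\rho_n\subseteq A^{B^n}$. $\rho^{\leftrightarrow}:=\bigcup_{n\in\mathbb N}\rho_n$. A (function) minion is a set $M\subseteq\bigcup_{n\in\mathbb N}A^{B^n}$ closed under minors: if $g:B^n\to A$ is in $M$ and $\pi:\{0,\dots,n-1\}\to\{0,\dots,m-1\}$ is any map ($m\in\mathbb N$), then $g^\pi:B^m\to A$, $g^\pi(x_0,\dots,x_{m-1})=g(x_{\pi(0)},\dots,x_{\pi(n-1)})$, is in $M$. (Equivalently, closed under permuting variables, identifying variables and adding fictitious variables.) *)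

theory Defs
  imports "HOL-Library.FuncSet"
begin

text \<open>
  The finite nonempty sets \<open>A\<close> and \<open>B\<close> are types \<open>'a\<close>, \<open>'b\<close> of class \<open>finite\<close>; an element of
  \<open>B\<^sup>n\<close> is a list of length \<open>n\<close>.  A function \<open>B\<^sup>n \<rightarrow> A\<close> is stored together with its arity \<open>n\<close>:
  without the tag, functions of different arities would be identified when \<open>A\<close> has only one
  element.
\<close>

type_synonym ('b, 'a) opn = "nat \<times> ('b list \<Rightarrow> 'a)"

definition tuples :: "nat \<Rightarrow> 'b list set"
  where "tuples n = {xs. length xs = n}"

definition opns :: "nat \<Rightarrow> ('b, 'a) opn set"
  where "opns n = {n} \<times> (tuples n \<rightarrow>\<^sub>E UNIV)"

definition mk_opn :: "nat \<Rightarrow> ('b list \<Rightarrow> 'a) \<Rightarrow> ('b, 'a) opn"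
  where "mk_opn n f = (n, restrict f (tuples n))"

text \<open>
  \<open>take i xs @ c # drop i xs\<close> is the tuple \<open>(x\<^sub>0, \<dots>, x\<^sub>i\<^sub>-\<^sub>1, c, x\<^sub>i, \<dots>, x\<^sub>n\<^sub>-\<^sub>1)\<close>.
\<close>

fun ebtrl :: "('b, 'a) opn \<Rightarrow> ('b, 'a) opn set" where
  "ebtrl (0, h) = {}"
| "ebtrl (Suc n, h) = {mk_opn n (\<lambda>xs. h (take i xs @ c # drop i xs)) | i c. i \<le> n}"

fun eftrl :: "('b, 'a) opn \<Rightarrow> ('b, 'a) opn set" where
  "eftrl (n, g) = {mk_opn (Suc n) (\<lambda>xs. g (tl xs)), mk_opn (Suc n) (\<lambda>xs. g (butlast xs))}"

fun Delta :: "('b, 'a) opn \<Rightarrow> ('b, 'a) opn set" where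
  "Delta (0, h) = {}"
| "Delta (Suc n, h) =
     {mk_opn n (\<lambda>xs. h (take j xs @ xs ! i # drop j xs)) | i j. i < j \<and> j \<le> n}"

definition ebtrl_set :: "('b, 'a) opn set \<Rightarrow> ('b, 'a) opn set"
  where "ebtrl_set \<rho> = (\<Union>h\<in>\<rho>. ebtrl h)"

definition eftrl_set :: "('b, 'a) opn set \<Rightarrow> ('b, 'a) opn set"
  where "eftrl_set \<rho> = (\<Union>g\<in>\<rho>. eftrl g)"

definition Delta_set :: "('b, 'a) opn set \<Rightarrow> ('b, 'a) opn set"
  where "Delta_set \<rho> = (\<Union>h\<in>\<rho>. Delta h)"

text \<open>
  In \<open>circledast n \<rho>\<close> and all notions below, the first argument is the exponent of the simple
  arity of \<open>\<rho>\<close>, which \<open>\<rho>\<close> itself does not determine when it is empty.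
\<close>

definition circledast :: "nat \<Rightarrow> ('b, 'a) opn set \<Rightarrow> ('b, 'a) opn set"
  where "circledast n \<rho> = {h \<in> opns (Suc n). ebtrl h \<subseteq> \<rho>}"

fun circledast_pow :: "nat \<Rightarrow> nat \<Rightarrow> ('b, 'a) opn set \<Rightarrow> ('b, 'a) opn set" where
  "circledast_pow d 0 \<rho> = \<rho>"
| "circledast_pow d (Suc k) \<rho> = circledast (d + k) (circledast_pow d k \<rho>)"

definition internally_reflexive :: "nat \<Rightarrow> ('b, 'a) opn set \<Rightarrow> bool"
  where "internally_reflexive d \<rho> \<longleftrightarrow> eftrl_set \<rho> \<subseteq> circledast d \<rho>"

definition transitive_rel :: "nat \<Rightarrow> ('b, 'a) opn set \<Rightarrow> bool"
  where "transitive_rel d \<rho> \<longleftrightarrow> Delta_set (circledast d \<rho>) \<subseteq> \<rho>"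

definition weak_generalized_quasiorder :: "nat \<Rightarrow> ('b, 'a) opn set \<Rightarrow> bool"
  where "weak_generalized_quasiorder d \<rho> \<longleftrightarrow> internally_reflexive d \<rho> \<and> transitive_rel d \<rho>"

definition level :: "nat \<Rightarrow> ('b, 'a) opn set \<Rightarrow> nat \<Rightarrow> ('b, 'a) opn set"
  where "level d \<rho> n =
    (if n > d then circledast_pow d (n - d) \<rho> else (ebtrl_set ^^ (d - n)) \<rho>)"

definition all_levels :: "nat \<Rightarrow> ('b, 'a) opn set \<Rightarrow> ('b, 'a) opn set"
  where "all_levels d \<rho> = (\<Union>n. level d \<rho> n)"

definition minor :: "nat \<Rightarrow> (nat \<Rightarrow> nat) \<Rightarrow> ('b, 'a) opn \<Rightarrow> ('b, 'a) opn"
  where "minor m \<pi> g = mk_opn m (\<lambda>xs. snd g (map (\<lambda>i. xs ! \<pi> i) [0..<fst g]))"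

definition minion :: "('b, 'a) opn set \<Rightarrow> bool"
  where "minion M \<longleftrightarrow> M \<subseteq> (\<Union>n. opns n) \<and>
    (\<forall>g \<in> M. \<forall>m. \<forall>\<pi> \<in> {..<fst g} \<rightarrow> {..<m}. minor m \<pi> g \<in> M)"

end

theory Submission imports Defs "HOL-Library.Multiset" begin

text \<open>
  All operators in play substitute variables or constants for the arguments of an operation.
  Such a substitution is a word over the letters \<open>Inl k\<close> (the variable \<open>x\<^sub>k\<close>) and \<open>Inr c\<close> (the
  constant \<open>c\<close>).  If \<open>\<rho>\<close> is a weak generalized quasiorder, then the \<open>n\<close>-th level consists of
  exactly those \<open>g\<close> all of whose \<open>d\<close>-ary substitution instances lie in \<open>\<rho>\<close>, a description that
  is visibly stable under minors.  The key point is that \<open>\<rho>\<close> itself is closed under all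
  substitutions: prepending a fictitious variable and then identifying or fixing variables deletes
  the first letter of a word and inserts an earlier letter or a constant elsewhere, and
  these moves reach every word from the identity word.  Above \<open>d\<close>, a word without constants
  repeats a letter, so transitivity lowers the arity.
\<close>

section \<open>Substitution words and their composition\<close>

definition subst :: "nat \<Rightarrow> (nat + 'b) list \<Rightarrow> ('b, 'a) opn \<Rightarrow> ('b, 'a) opn"
  where "subst m w g = mk_opn m (\<lambda>xs. snd g (map (case_sum ((!) xs) id) w))"

definition words :: "nat \<Rightarrow> nat \<Rightarrow> (nat + 'b) list set"
  where "words n m = {w. length w = n \<and> set w \<subseteq> {..<m} <+> UNIV}"

definition id_word :: "nat \<Rightarrow> (nat + 'b) list"
  where "id_word n = map Inl [0..<n]"

definition insert_at :: "nat \<Rightarrow> 'c \<Rightarrow> 'c list \<Rightarrow> 'c list"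
  where "insert_at i a v = take i v @ a # drop i v"

text \<open>One condition, uniform in \<open>n\<close>, meant to replace the upward and the downward
  recursion in \<open>level\<close>.\<close>

definition instances_in :: "nat \<Rightarrow> ('b, 'a) opn set \<Rightarrow> nat \<Rightarrow> ('b, 'a) opn set"
  where "instances_in d \<rho> n = {g \<in> opns n. \<forall>w \<in> words n d. subst d w g \<in> \<rho>}"

lemma Inl_in_Plus_iff [simp]: "Inl x \<in> A <+> B \<longleftrightarrow> x \<in> A"
  by auto

lemma Inr_in_Plus_iff [simp]: "Inr x \<in> A <+> B \<longleftrightarrow> x \<in> B"
  by auto

lemma mk_opn_in_opns [simp]: "mk_opn n f \<in> opns n"
  by (auto simp: mk_opn_def opns_def)

lemma subst_in_opns [simp]: "subst n w g \<in> opns n"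
  by (simp add: subst_def)

lemma fst_opns: "g \<in> opns n \<Longrightarrow> fst g = n"
  by (auto simp: opns_def)

lemma mk_opn_cong: "(\<And>xs. length xs = n \<Longrightarrow> f xs = g xs) \<Longrightarrow> mk_opn n f = mk_opn n g"
  by (auto simp: mk_opn_def tuples_def restrict_def fun_eq_iff)

lemma mk_opn_snd: "g \<in> opns n \<Longrightarrow> mk_opn n (snd g) = g"
  by (auto simp: mk_opn_def opns_def)

lemma map_id_word: "length xs = n \<Longrightarrow> map (case_sum ((!) xs) f) (id_word n) = xs"
  by (auto simp: id_word_def o_def intro: nth_equalityI)

lemma map_insert_at: "map f (insert_at i a v) = insert_at i (f a) (map f v)"
  by (simp add: insert_at_def take_map drop_map)

lemma set_insert_at [simp]: "set (insert_at i a v) = insert a (set v)"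
  by (metis Un_insert_right append_take_drop_id insert_at_def list.simps(15) set_append)

lemma length_insert_at [simp]: "length (insert_at i a v) = Suc (length v)"
  by (simp add: insert_at_def)

lemma insert_at_remove:
  "i < length w \<Longrightarrow> insert_at i (w ! i) (take i w @ drop (Suc i) w) = w"
  by (simp add: insert_at_def min_def id_take_nth_drop[symmetric])

lemma id_word_in_words: "n \<le> m \<Longrightarrow> id_word n \<in> words n m"
  by (auto simp: id_word_def words_def)

lemma insert_at_in_words:
  "v \<in> words n m \<Longrightarrow> a \<in> {..<m} <+> UNIV \<Longrightarrow> insert_at i a v \<in> words (Suc n) m"
  by (auto simp: words_def)

lemma remove_in_words:
  "w \<in> words (Suc n) m \<Longrightarrow> i \<le> n \<Longrightarrow> take i w @ drop (Suc i) w \<in> words n m"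
  unfolding words_def
  by (auto dest!: in_set_takeD in_set_dropD)

lemma nth_in_letters: "w \<in> words n m \<Longrightarrow> i < n \<Longrightarrow> w ! i \<in> {..<m} <+> UNIV"
  by (auto simp: words_def)

text \<open>The composite word arises by looking up the variables of \<open>w\<close> in
  \<open>v\<close>, while constants stay.\<close>

lemma subst_subst:
  assumes "w \<in> words n l" "v \<in> words l k"
  shows "subst m v (subst l w g) = subst m (map (case_sum ((!) v) Inr) w) g"
proof -
  have "map (case_sum ((!) (map (case_sum ((!) xs) id) v)) id) w
      = map (case_sum ((!) xs) id) (map (case_sum ((!) v) Inr) w)" for xs
    using assms by (auto simp: words_def)
  \<comment> \<open>As \<open>v\<close> has length \<open>l\<close>, the intermediate operation is
    evaluated inside its domain, where \<open>restrict\<close> changes nothing.\<close>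
  moreover have "snd (mk_opn l f) (map p v) = f (map p v)" for f :: "'a list \<Rightarrow> 'b" and p
    using assms(2) by (simp add: mk_opn_def tuples_def words_def)
  ultimately show ?thesis by (simp only: subst_def)
qed

lemma subst_id_word: "g \<in> opns n \<Longrightarrow> subst n (id_word n) g = g"
  by (metis (no_types, lifting) map_id_word mk_opn_cong mk_opn_snd subst_def)

lemma compose_in_words:
  assumes "w \<in> words n l" "v \<in> words l k"
  shows "map (case_sum ((!) v) Inr) w \<in> words n k"
  using assms nth_in_letters[OF assms(2)] by (fastforce simp: words_def)

lemma minor_eq_subst: "minor m \<pi> g = subst m (map (Inl \<circ> \<pi>) [0..<fst g]) g"
  by (simp add: minor_def subst_def o_def)

text \<open>The identity word composed with \<open>v\<close> is \<open>v\<close>, so the only letter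
  left to look up is the inserted one.\<close>

lemma subst_insert_at:
  assumes "v \<in> words n k" "a \<in> {..<n} <+> UNIV"
  shows "subst m v (subst n (insert_at i a (id_word n)) h)
       = subst m (insert_at i (case_sum ((!) v) Inr a) v) h"
proof -
  have "insert_at i a (id_word n) \<in> words (Suc n) n"
    using assms(2) by (intro insert_at_in_words id_word_in_words) auto
  from subst_subst[OF this assms(1)] show ?thesis
    using assms(1) by (simp add: map_insert_at map_id_word words_def)
qed

lemma subst_insert_variable:
  "v \<in> words n k \<Longrightarrow> l < n \<Longrightarrow>
    subst m v (subst n (insert_at i (Inl l) (id_word n)) h) = subst m (insert_at i (v ! l) v) h"
  using subst_insert_at[of v n k "Inl l"] by simp

lemma subst_insert_constant:
  "v \<in> words n k \<Longrightarrow>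
    subst m v (subst n (insert_at i (Inr c) (id_word n)) h) = subst m (insert_at i (Inr c) v) h"
  using subst_insert_at[of v n k "Inr c"] by simp

section \<open>The operators \<open>ebtrl\<close>, \<open>Delta\<close> and \<open>eftrl\<close> as
  substitutions\<close>

lemma ebtrl_eq:
  assumes "h \<in> opns (Suc n)"
  shows "ebtrl h = {subst n (insert_at i (Inr c) (id_word n)) h | i c. i \<le> n}"
proof -
  obtain f where h: "h = (Suc n, f)" using assms by (auto simp: opns_def)
  have "mk_opn n (\<lambda>xs. f (take i xs @ c # drop i xs))
      = subst n (insert_at i (Inr c) (id_word n)) h" for i c
    unfolding subst_def
    by (rule mk_opn_cong) (simp add: h map_insert_at map_id_word, simp add: insert_at_def)
  then show ?thesis by (simp add: h)
qed

lemma Delta_eq: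
  assumes "h \<in> opns (Suc n)"
  shows "Delta h = {subst n (insert_at j (Inl i) (id_word n)) h | i j. i < j \<and> j \<le> n}"
proof -
  obtain f where h: "h = (Suc n, f)" using assms by (auto simp: opns_def)
  have "mk_opn n (\<lambda>xs. f (take j xs @ xs ! i # drop j xs))
      = subst n (insert_at j (Inl i) (id_word n)) h" for i j
    unfolding subst_def
    by (rule mk_opn_cong) (simp add: h map_insert_at map_id_word, simp add: insert_at_def)
  then show ?thesis by (simp add: h)
qed

lemma eftrl_eq:
  assumes "g \<in> opns n"
  shows "eftrl g = {subst (Suc n) (tl (id_word (Suc n))) g, subst (Suc n) (id_word n) g}"
proof -
  obtain f where g: "g = (n, f)" using assms by (auto simp: opns_def)
  \<comment> \<open>Read in arity \<open>Suc n\<close>, the word \<open>id_word n\<close> leaves out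
    the last variable.\<close>
  have *: "map (case_sum ((!) xs) id) (id_word n) = butlast xs" if "length xs = Suc n"
    for xs :: "'a list"
    using that by (intro nth_equalityI) (auto simp: id_word_def nth_butlast)
  have "mk_opn (Suc n) (\<lambda>xs. f (tl xs)) = subst (Suc n) (tl (id_word (Suc n))) g"
    unfolding subst_def by (rule mk_opn_cong) (simp add: g map_tl map_id_word)
  moreover have "mk_opn (Suc n) (\<lambda>xs. f (butlast xs)) = subst (Suc n) (id_word n) g"
    unfolding subst_def by (rule mk_opn_cong) (simp add: g *)
  ultimately show ?thesis by (simp add: g)
qed

lemma tl_id_word: "tl (id_word (Suc n)) = map (Inl \<circ> Suc) [0..<n]"
  by (simp add: id_word_def map_tl[symmetric] map_Suc_upt[symmetric] del: upt_Suc)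

lemma tl_id_word_in_words: "tl (id_word (Suc n)) \<in> words n (Suc n)"
  unfolding tl_id_word by (auto simp: words_def)

section \<open>Rearranging words by elementary moves\<close>

text \<open>Adjacent transpositions generate all permutations. The prefix \<open>u\<close> lets the
  induction park the head of \<open>xs\<close>, arrange the tail, and then move the head right to
  its place in \<open>ys\<close>.\<close>

lemma mset_closed_if_swap_closed:
  assumes swap: "\<And>u a b v. P (u @ a # b # v) \<Longrightarrow> P (u @ b # a # v)"
  shows "mset xs = mset ys \<Longrightarrow> P (u @ xs) \<Longrightarrow> P (u @ ys)"
proof (induction xs arbitrary: u ys)
  case Nil
  then show ?case by simp
next
  case (Cons a xs)
  have bubble: "P (u @ s @ a # t)" if "P (u @ a # s @ t)" for u s t
    using that
  proof (induction s arbitrary: u)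
    case (Cons b s)
    then show ?case using swap[of u a b "s @ t"] Cons.IH[of "u @ [b]"] by simp
  qed simp
  have "a \<in> set ys" using Cons.prems(1) by (metis list.set_intros(1) mset_eq_setD)
  then obtain s t where ys: "ys = s @ a # t" by (meson split_list)
  have "P ((u @ [a]) @ (s @ t))"
    by (rule Cons.IH) (use Cons.prems in \<open>simp_all add: ys\<close>)
  then show ?case using bubble[of u s t] by (simp add: ys)
qed

text \<open>Rotate the two letters to the front, swap them there, and rotate back.\<close>

lemma swap_closed_if_rotate_closed:
  assumes rotate: "\<And>a v. P (a # v) \<Longrightarrow> P (v @ [a])"
    and swap: "\<And>a b v. P (a # b # v) \<Longrightarrow> P (b # a # v)"
  assumes "P (u @ a # b # v)"
  shows "P (u @ b # a # v)"
proof -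
  have rot: "P (t @ s)" if "P (s @ t)" for s t
    using that
  proof (induction s arbitrary: t)
    case (Cons c s)
    then show ?case using rotate[of c "s @ t"] Cons.IH[of "t @ [c]"] by simp
  qed simp
  have "P (a # b # v @ u)" using rot[of u "a # b # v"] assms(3) by simp
  then have "P (([b, a] @ v) @ u)" using swap by simp
  from rot[OF this] show ?thesis by simp
qed

text \<open>
  Letters outside \<open>K\<close> can be inserted only if they are present.  Replacing a surplus letter
  by a missing one never removes the last occurrence of a letter of the target.
\<close>

lemma mset_reachable:
  fixes T :: "'c multiset"
  assumes replace: "\<And>S a u. Q (add_mset a S) \<Longrightarrow> u \<in> K \<union> set_mset S \<Longrightarrow> Q (add_mset u S)"
  shows "Q S \<Longrightarrow> size S = size T \<Longrightarrow> set_mset T \<subseteq> K \<union> set_mset S \<Longrightarrow> Q T"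
\<comment> \<open>The measure counts the letters of \<open>T\<close>, with multiplicity, that
  \<open>S\<close> still lacks; each replacement lowers it by one.\<close>
proof (induction "size (T - S)" arbitrary: S rule: less_induct)
  case less
  show ?case
  proof (cases "T \<subseteq># S")
    case True
    then have "T = S"
      using less.prems(2) by (metis mset_subset_size nless_le subset_mset.le_less)
    then show ?thesis using less.prems(1) by simp
  next
    case False
    then obtain u where u: "count S u < count T u"
      by (auto simp: subseteq_mset_def not_le)
    have "\<not> S \<subseteq># T"
      using False less.prems(2) by (metis mset_subset_size nless_le subset_mset.le_less)
    then obtain a where a: "count T a < count S a"
      by (auto simp: subseteq_mset_def not_le)
    have "a \<in># S" using a by (metis count_inI less_zeroE)
    then obtain R where S: "S = add_mset a R" by (meson mset_add)
    have "a \<noteq> u" using a u by auto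
    have "u \<in># T" using u by (metis count_inI less_zeroE)
    then have "u \<in> K \<union> set_mset R" using less.prems(3) \<open>a \<noteq> u\<close> by (auto simp: S)
    then have "Q (add_mset u R)" using replace less.prems(1) S by blast
    moreover have "T - S = add_mset u (T - add_mset u R)"
      using a u by (intro multiset_eqI) (auto simp: S split: if_splits)
    then have "size (T - add_mset u R) < size (T - S)" by simp
    moreover have "set_mset T \<subseteq> K \<union> set_mset (add_mset u R)"
    proof
      fix x assume x: "x \<in># T"
      show "x \<in> K \<union> set_mset (add_mset u R)"
      proof (cases "x = a")
        case True
        \<comment> \<open>A surplus letter that occurs in \<open>T\<close> has at least two copies
          in \<open>S\<close>, so one survives in \<open>R\<close>.\<close>
        have "a \<in># R" using a x True by (simp add: S flip: count_greater_zero_iff)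
        then show ?thesis using True by simp
      next
        case False
        then show ?thesis using x less.prems(3) by (auto simp: S)
      qed
    qed
    ultimately show ?thesis
      using less.hyps less.prems(2) by (simp add: S)
  qed
qed

section \<open>Operations described by their \<open>d\<close>-ary instances\<close>

text \<open>An instance of an instance is an instance, by composing words. This covers minors and
  the fixing of arguments in all arities at once.\<close>

lemma instances_in_subst:
  assumes "g \<in> instances_in d \<rho> n" "w \<in> words n m"
  shows "subst m w g \<in> instances_in d \<rho> m"
  using assms by (auto simp: instances_in_def subst_subst compose_in_words)

lemma ebtrl_instances_in: "g \<in> instances_in d \<rho> (Suc n) \<Longrightarrow> ebtrl g \<subseteq> instances_in d \<rho> n"
  by (subst ebtrl_eq[where n = n])
    (auto simp: instances_in_def[of d \<rho> "Suc n"]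
      intro!: instances_in_subst[where n = "Suc n"] insert_at_in_words id_word_in_words)

text \<open>For the inclusion from right to left, \<open>g\<close> is recovered by adding a
  fictitious last variable and then fixing it.\<close>

lemma ebtrl_set_instances_in:
  "ebtrl_set (instances_in d \<rho> (Suc n)) = instances_in d \<rho> n"
proof
  show "ebtrl_set (instances_in d \<rho> (Suc n)) \<subseteq> instances_in d \<rho> n"
    using ebtrl_instances_in unfolding ebtrl_set_def by (rule UN_least)
  show "instances_in d \<rho> n \<subseteq> ebtrl_set (instances_in d \<rho> (Suc n))"
  proof
    fix g assume g: "g \<in> instances_in d \<rho> n"
    define f where "f = subst (Suc n) (id_word n) g"
    have f: "f \<in> instances_in d \<rho> (Suc n)"
      unfolding f_def by (rule instances_in_subst[OF g id_word_in_words]) simp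
    \<comment> \<open>\<open>undefined\<close> serves as an arbitrary constant: the variable that it
      fixes is fictitious in \<open>f\<close>.\<close>
    define v :: "(nat + 'a) list" where "v = insert_at n (Inr undefined) (id_word n)"
    have v: "v \<in> words (Suc n) n"
      unfolding v_def by (intro insert_at_in_words id_word_in_words) auto
    have "map (case_sum ((!) v) Inr) (id_word n) = id_word n"
      by (auto simp: v_def insert_at_def id_word_def nth_append)
    then have "subst n v f = subst n (id_word n) g"
      unfolding f_def using subst_subst[OF id_word_in_words[of n "Suc n"] v] by simp
    also have "\<dots> = g" using g by (auto simp: instances_in_def subst_id_word)
    finally have "g \<in> ebtrl f"
      unfolding v_def by (subst ebtrl_eq[where n = n]) (force simp: f_def)+
    then show "g \<in> ebtrl_set (instances_in d \<rho> (Suc n))"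
      using f by (auto simp: ebtrl_set_def)
  qed
qed

section \<open>Weak generalized quasiorders are closed under substitution\<close>

text \<open>The elementary move on words. Internal reflexivity puts \<open>g\<close> with a
  fictitious first variable into \<open>circledast d \<rho>\<close>. From there \<open>ebtrl\<close>
  inserts a constant, and transitivity repeats an earlier letter. As \<open>0 < j\<close>, the
  letter dropped is the first one of \<open>w\<close>, not the new one.\<close>

lemma subst_closed_insert:
  assumes \<rho>: "\<rho> \<subseteq> opns d" and wgq: "weak_generalized_quasiorder d \<rho>"
    and w: "w \<in> words d d" "\<And>g. g \<in> \<rho> \<Longrightarrow> subst d w g \<in> \<rho>"
    and j: "0 < j" "j \<le> d" and a: "a \<in> set (take j w) \<union> range Inr"
    and g: "g \<in> \<rho>"
  shows "subst d (tl (insert_at j a w)) g \<in> \<rho>"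
proof -
  define h where "h = subst (Suc d) (tl (id_word (Suc d))) g"
  have "h \<in> eftrl g" using g \<rho> by (auto simp: h_def eftrl_eq)
  then have h: "h \<in> circledast d \<rho>"
    using wgq g by (auto simp: weak_generalized_quasiorder_def internally_reflexive_def eftrl_set_def)
  then have h_opns: "h \<in> opns (Suc d)" and ebtrl: "ebtrl h \<subseteq> \<rho>"
    by (auto simp: circledast_def)
  have Delta: "Delta h \<subseteq> \<rho>"
    using wgq h by (auto simp: weak_generalized_quasiorder_def transitive_rel_def Delta_set_def)
  \<comment> \<open>\<open>b\<close> is a letter that \<open>w\<close> turns into \<open>a\<close>:
    a constant represents itself, a variable is represented by a position before \<open>j\<close>
    where \<open>w\<close> has it.\<close>
  obtain b where b: "b \<in> {..<d} <+> UNIV" "case_sum ((!) w) Inr b = a"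
    and in_\<rho>: "subst d (insert_at j b (id_word d)) h \<in> \<rho>"
  proof (cases a)
    case (Inr c)
    have "subst d (insert_at j (Inr c) (id_word d)) h \<in> ebtrl h"
      using j by (auto simp: ebtrl_eq[OF h_opns])
    then show ?thesis using that[of "Inr c"] ebtrl Inr by auto
  next
    case (Inl k)
    with a have "a \<in> set (take j w)" by auto
    then obtain i where "i < j" "w ! i = a"
      by (auto simp: in_set_conv_nth)
    then have "subst d (insert_at j (Inl i) (id_word d)) h \<in> Delta h"
      using j by (auto simp: Delta_eq[OF h_opns])
    then show ?thesis
      using that[of "Inl i"] Delta \<open>i < j\<close> \<open>w ! i = a\<close> j by auto
  qed
  have "a \<in> {..<d} <+> UNIV"
    using a w(1) by (auto simp: words_def dest!: in_set_takeD)
  then have ins: "insert_at j a w \<in> words (Suc d) d"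
    using w(1) by (intro insert_at_in_words)
  have "subst d w (subst d (insert_at j b (id_word d)) h) = subst d (insert_at j a w) h"
    using b w(1) by (simp add: subst_insert_at)
  \<comment> \<open>\<open>h\<close> ignores its first argument, so the first letter of the word
    disappears.\<close>
  also have "\<dots> = subst d (tl (insert_at j a w)) g"
    unfolding h_def using subst_subst[OF tl_id_word_in_words ins] ins
    by (simp add: map_tl map_id_word words_def)
  finally show ?thesis using w(2) in_\<rho> by metis
qed

text \<open>Rotations and a swap at the front make admissibility of a word depend only on its
  multiset of letters. Single replacements then lead from the identity word, which has every
  variable, to \<open>w\<close>.\<close>

lemma subst_closed:
  assumes \<rho>: "\<rho> \<subseteq> opns d" and wgq: "weak_generalized_quasiorder d \<rho>"
    and w: "w \<in> words d d" and g: "g \<in> \<rho>"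
  shows "subst d w g \<in> \<rho>"
proof -
  define P where "P = (\<lambda>w. w \<in> words d d \<and> (\<forall>g\<in>\<rho>. subst d w g \<in> \<rho>))"
  have P_insert: "P (tl (insert_at j a w))"
    if "P w" "0 < j" "j \<le> d" "a \<in> set (take j w) \<union> range Inr" for w j a
  proof -
    have "a \<in> {..<d} <+> UNIV" "length w = d" "set w \<subseteq> {..<d} <+> UNIV"
      using that by (auto simp: words_def P_def dest!: in_set_takeD)
    moreover have "set (tl (insert_at j a w)) \<subseteq> set (insert_at j a w)"
      by (cases "insert_at j a w") auto
    ultimately have "tl (insert_at j a w) \<in> words d d" by (auto simp: words_def)
    then show ?thesis
      using that subst_closed_insert[OF \<rho> wgq, of w j a] by (auto simp: P_def)
  qed
  \<comment> \<open>The move with \<open>j = d\<close> appends a letter at the end; it may be the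
    letter just dropped, which gives rotation.\<close>
  have P_replace: "P (v @ [u])" if "P (a # v)" "u \<in> insert a (set v) \<union> range Inr" for a v u
  proof -
    have "d = Suc (length v)" using that by (auto simp: P_def words_def)
    then show ?thesis
      using P_insert[of "a # v" d u] that by (auto simp: insert_at_def)
  qed
  \<comment> \<open>The move with \<open>j = 2\<close> turns \<open>a # b # v\<close> into
    \<open>a # b # a # v\<close> and then drops the first \<open>a\<close>.\<close>
  have P_swap: "P (b # a # v)" if "P (a # b # v)" for a b v
  proof -
    have "d = Suc (Suc (length v))" using that by (auto simp: P_def words_def)
    then show ?thesis
      using P_insert[of "a # b # v" 2 a] that by (simp add: insert_at_def)
  qed
  have P_rotate: "P (v @ [a])" if "P (a # v)" for a v
    using P_replace[OF that] by simp
  have P_swap_inner: "P (u @ b # a # v)" if "P (u @ a # b # v)" for u a b v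
    by (rule swap_closed_if_rotate_closed[of P]) (fact P_rotate P_swap that)+
  have P_mset: "P ys" if "mset xs = mset ys" "P xs" for xs ys
    using mset_closed_if_swap_closed[of P xs ys "[]"] P_swap_inner that by simp
  define Q where "Q = (\<lambda>S. \<exists>w. mset w = S \<and> P w)"
  have "Q (mset w)"
  proof (rule mset_reachable)
    show "Q (mset (id_word d))"
      unfolding Q_def P_def
      by (intro exI[of _ "id_word d"])
        (simp add: id_word_in_words subst_id_word[OF subsetD[OF \<rho>]])
    show "size (mset (id_word d :: (nat + 'a) list)) = size (mset w)"
      using w by (simp add: id_word_def words_def)
    show "set_mset (mset w) \<subseteq> range Inr \<union> set_mset (mset (id_word d))"
      using w by (auto simp: id_word_def words_def)
    show "Q (add_mset u S)"
      if Q: "Q (add_mset a S)" and u: "u \<in> range Inr \<union> set_mset S" for S a u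
    proof -
      obtain w where "mset w = add_mset a S" "P w" using Q by (auto simp: Q_def)
      moreover obtain v where v: "mset v = S" using ex_mset by blast
      ultimately have "P (a # v)" using P_mset[of w "a # v"] by simp
      then have "P (v @ [u])" using P_replace[of a v u] u v by auto
      then show ?thesis using v by (auto simp: Q_def intro!: exI[of _ "v @ [u]"])
    qed
  qed
  then have "P w" using P_mset by (auto simp: Q_def)
  then show ?thesis using g by (simp add: P_def)
qed

lemma instances_in_eq:
  assumes "\<rho> \<subseteq> opns d" "weak_generalized_quasiorder d \<rho>"
  shows "instances_in d \<rho> d = \<rho>"
proof
  show "instances_in d \<rho> d \<subseteq> \<rho>"
  proof
    fix g assume "g \<in> instances_in d \<rho> d"
    then show "g \<in> \<rho>"
      using subst_id_word[of g d] id_word_in_words[of d d] by (force simp: instances_in_def)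
  qed
  show "\<rho> \<subseteq> instances_in d \<rho> d"
    using assms subst_closed[OF assms] by (auto simp: instances_in_def)
qed

section \<open>The operator \<open>circledast\<close> from arity \<open>d\<close> upward\<close>

text \<open>Fixing the argument that carries the constant is a step of \<open>ebtrl\<close> and
  leads into \<open>instances_in d \<rho> n\<close>; the other letters of \<open>w\<close> form a
  \<open>d\<close>-ary instance there.\<close>

lemma circledast_instance_constant:
  assumes h: "h \<in> circledast n (instances_in d \<rho> n)"
    and w: "w \<in> words (Suc n) d" and c: "Inr c \<in> set w"
  shows "subst d w h \<in> \<rho>"
proof -
  obtain i where i: "i \<le> n" "w ! i = Inr c"
    using c w by (auto simp: in_set_conv_nth words_def less_Suc_eq_le)
  define v where "v = take i w @ drop (Suc i) w"
  have v: "v \<in> words n d" using remove_in_words[OF w i(1)] by (simp add: v_def)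
  have "insert_at i (Inr c) v = w"
    using insert_at_remove[of i w] i w by (simp add: v_def words_def)
  then have "subst d v (subst n (insert_at i (Inr c) (id_word n)) h) = subst d w h"
    using subst_insert_constant[OF v] by metis
  moreover have "subst n (insert_at i (Inr c) (id_word n)) h \<in> ebtrl h"
    using h i by (subst ebtrl_eq[where n = n]) (auto simp: circledast_def)
  then have "subst n (insert_at i (Inr c) (id_word n)) h \<in> instances_in d \<rho> n"
    using h by (auto simp: circledast_def)
  ultimately show ?thesis using v by (metis (no_types, lifting) instances_in_def mem_Collect_eq)
qed

text \<open>Pigeonhole: \<open>Suc n > d\<close> positions share \<open>d\<close> variables.\<close>

lemma repeated_letter:
  assumes w: "w \<in> words (Suc n) d" and "d \<le> n" and "\<And>c. Inr c \<notin> set w"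
  obtains i j where "i < j" "j \<le> n" "w ! i = w ! j"
proof -
  have "set w \<subseteq> Inl ` {..<d}" using w assms(3) by (auto simp: words_def)
  then have "card (set w) \<le> d"
    using card_mono[of "Inl ` {..<d}" "set w"] by (simp add: card_image)
  then have "\<not> distinct w"
    using w \<open>d \<le> n\<close> by (auto simp: words_def dest: distinct_card)
  then show ?thesis
    using w that by (auto simp: distinct_conv_nth words_def less_Suc_eq_le) (metis nat_neq_iff)
qed

text \<open>Transitivity of \<open>\<rho>\<close> speaks about arity \<open>d\<close> only. For a
  word without constants, arguments carrying equal letters are therefore identified one pair at a
  time, until that arity is reached or a constant settles the case.\<close>

lemma circledast_instance:
  assumes \<rho>: "\<rho> \<subseteq> opns d" and wgq: "weak_generalized_quasiorder d \<rho>"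
  shows "d \<le> n \<Longrightarrow> h \<in> circledast n (instances_in d \<rho> n) \<Longrightarrow> w \<in> words (Suc n) d
    \<Longrightarrow> subst d w h \<in> \<rho>"
proof (induction n arbitrary: h w rule: less_induct)
  case (less n)
  note h = less.prems(2) and w = less.prems(3)
  show ?case
  proof (cases "\<exists>c. Inr c \<in> set w")
    case True
    then show ?thesis using circledast_instance_constant[OF h w] by blast
  next
    case False
    then obtain i j where ij: "i < j" "j \<le> n" "w ! i = w ! j"
      using repeated_letter[OF w less.prems(1)] by blast
    define v where "v = take j w @ drop (Suc j) w"
    have v: "v \<in> words n d" using remove_in_words[OF w ij(2)] by (simp add: v_def)
    \<comment> \<open>Position \<open>i\<close> lies before the deleted position \<open>j\<close>,
      so its letter keeps its index.\<close>
    have "v ! i = w ! j" using ij w by (simp add: v_def nth_append words_def)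
    then have w_eq: "w = insert_at j (v ! i) v"
      using insert_at_remove[of j w] ij w by (simp add: v_def words_def)
    have h_opns: "h \<in> opns (Suc n)" using h by (simp add: circledast_def)
    define g where "g = subst n (insert_at j (Inl i) (id_word n)) h"
    have g_subst: "subst m x g = subst m (insert_at j (x ! i) x) h" if "x \<in> words n k" for m x k
      unfolding g_def by (rule subst_insert_variable[OF that]) (use ij in simp)
    have g_Delta: "g \<in> Delta h" using ij by (auto simp: g_def Delta_eq[OF h_opns])
    have "subst d v g \<in> \<rho>"
    proof (cases "n = d")
      case True
      then have "g \<in> \<rho>"
        using wgq g_Delta h instances_in_eq[OF \<rho> wgq]
        by (auto simp: weak_generalized_quasiorder_def transitive_rel_def Delta_set_def)
      then show ?thesis using subst_closed[OF \<rho> wgq] v True by blast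
    next
      case False
      then obtain m where m: "n = Suc m" "d \<le> m"
        using less.prems(1) by (cases n) auto
      \<comment> \<open>To apply the induction hypothesis to \<open>g\<close>, its
        \<open>ebtrl\<close> must be controlled. An instance of \<open>g\<close> with a constant is
        an instance of \<open>h\<close> with that constant, and those are settled already.\<close>
      have "subst m (insert_at k (Inr c) (id_word m)) g \<in> instances_in d \<rho> m" if "k \<le> m" for k c
      proof -
        have "subst d u (subst m (insert_at k (Inr c) (id_word m)) g) \<in> \<rho>"
          if u: "u \<in> words m d" for u
        proof -
          define x where "x = insert_at k (Inr c) u"
          have x: "x \<in> words n d"
            unfolding x_def m(1) by (rule insert_at_in_words[OF u]) auto
          have "x ! i \<in> {..<d} <+> UNIV" using nth_in_letters[OF x] ij by simp
          then have "insert_at j (x ! i) x \<in> words (Suc n) d"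
            by (rule insert_at_in_words[OF x])
          moreover have "Inr c \<in> set (insert_at j (x ! i) x)" by (simp add: x_def)
          ultimately have "subst d (insert_at j (x ! i) x) h \<in> \<rho>"
            by (rule circledast_instance_constant[OF h])
          moreover have "subst d u (subst m (insert_at k (Inr c) (id_word m)) g) = subst d x g"
            unfolding x_def by (rule subst_insert_constant[OF u])
          ultimately show ?thesis using g_subst[OF x] by simp
        qed
        then show ?thesis by (simp add: instances_in_def)
      qed
      then have "g \<in> circledast m (instances_in d \<rho> m)"
        using ebtrl_eq[of g m] by (auto simp: circledast_def g_def m)
      then show ?thesis using less.IH[of m g v] m v by simp
    qed
    then show ?thesis using g_subst[OF v] w_eq by simp
  qed
qed

lemma circledast_instances_in:
  assumes "\<rho> \<subseteq> opns d" "weak_generalized_quasiorder d \<rho>" "d \<le> n"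
  shows "circledast n (instances_in d \<rho> n) = instances_in d \<rho> (Suc n)"
proof
  show "circledast n (instances_in d \<rho> n) \<subseteq> instances_in d \<rho> (Suc n)"
    using circledast_instance[OF assms] by (auto simp: instances_in_def circledast_def)
  show "instances_in d \<rho> (Suc n) \<subseteq> circledast n (instances_in d \<rho> n)"
    using ebtrl_instances_in[of _ d \<rho> n] by (auto simp: circledast_def) (simp add: instances_in_def)
qed

section \<open>Levels, minors and the equivalence\<close>

text \<open>Both recursions start from \<open>\<rho>\<close> at arity \<open>d\<close>;
  \<open>circledast\<close> follows \<open>instances_in\<close> upward and \<open>ebtrl_set\<close>
  follows it downward.\<close>

lemma level_eq_instances_in:
  assumes \<rho>: "\<rho> \<subseteq> opns d" and wgq: "weak_generalized_quasiorder d \<rho>"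
  shows "level d \<rho> n = instances_in d \<rho> n"
proof (cases "n > d")
  case True
  have "circledast_pow d k \<rho> = instances_in d \<rho> (d + k)" for k
    by (induction k) (use instances_in_eq[OF assms] circledast_instances_in[OF assms] in auto)
  then show ?thesis using True by (simp add: level_def)
next
  case False
  have "k \<le> d \<Longrightarrow> (ebtrl_set ^^ k) \<rho> = instances_in d \<rho> (d - k)" for k
  proof (induction k)
    case 0
    then show ?case using instances_in_eq[OF assms] by simp
  next
    case (Suc k)
    then show ?case
      using ebtrl_set_instances_in[of d \<rho> "d - Suc k"] by (simp add: Suc_diff_Suc)
  qed
  then show ?thesis using False by (simp add: level_def)
qed

lemma minor_instances_in:
  assumes "g \<in> instances_in d \<rho> n" "\<pi> \<in> {..<fst g} \<rightarrow> {..<m}"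
  shows "minor m \<pi> g \<in> instances_in d \<rho> m"
proof -
  have "fst g = n" using assms(1) by (simp add: instances_in_def fst_opns)
  then have "map (Inl \<circ> \<pi>) [0..<fst g] \<in> words n m"
    using assms(2) by (auto simp: words_def)
  then show ?thesis
    unfolding minor_eq_subst by (rule instances_in_subst[OF assms(1)])
qed

lemma ebtrl_set_opns: "\<rho> \<subseteq> opns (Suc n) \<Longrightarrow> ebtrl_set \<rho> \<subseteq> opns n"
  by (fastforce simp: ebtrl_set_def ebtrl_eq)

lemma level_subset_opns:
  assumes "\<rho> \<subseteq> opns d"
  shows "level d \<rho> n \<subseteq> opns n"
proof (cases "n > d")
  case True
  \<comment> \<open>The outermost \<open>circledast\<close>, at exponent \<open>n - 1\<close>,
    already forces arity \<open>n\<close>.\<close>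
  then obtain k where "n - d = Suc k" "d + k = n - 1" by (cases "n - d") auto
  then show ?thesis using True by (auto simp: level_def circledast_def)
next
  case False
  have "k \<le> d \<Longrightarrow> (ebtrl_set ^^ k) \<rho> \<subseteq> opns (d - k)" for k
  proof (induction k)
    case 0
    then show ?case using assms by simp
  next
    case (Suc k)
    then show ?case using ebtrl_set_opns[of _ "d - Suc k"] by (simp add: Suc_diff_Suc)
  qed
  from this[of "d - n"] show ?thesis using False by (simp add: level_def)
qed

text \<open>The arity tag keeps levels disjoint, so closure of their union can be read off level by
  level.\<close>

lemma all_levels_at_arity:
  assumes "\<rho> \<subseteq> opns d" "g \<in> all_levels d \<rho>" "g \<in> opns n"
  shows "g \<in> level d \<rho> n"
proof -
  obtain m where m: "g \<in> level d \<rho> m" using assms(2) by (auto simp: all_levels_def)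
  then have "g \<in> opns m" using level_subset_opns[OF assms(1)] by blast
  then show ?thesis using m assms(3) fst_opns by metis
qed

text \<open>A word without constants is a map between variable indices, so the substitution is a
  minor.\<close>

lemma minion_subst_variables:
  assumes "minion M" "g \<in> M" "g \<in> opns n" "w \<in> words n m" "set w \<subseteq> range Inl"
  shows "subst m w g \<in> M"
proof -
  define \<pi> where "\<pi> i = projl (w ! i)" for i
  have n: "fst g = n" "length w = n" using assms by (auto simp: fst_opns words_def)
  have *: "w ! i = Inl (\<pi> i)" if "i < n" for i
    using assms(5) n(2) that nth_mem[of i w] by (fastforce simp: \<pi>_def)
  then have "\<pi> \<in> {..<fst g} \<rightarrow> {..<m}"
    using nth_in_letters[OF assms(4)] n by fastforce
  moreover have "map (Inl \<circ> \<pi>) [0..<fst g] = w"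
    using * n by (auto intro: nth_equalityI)
  ultimately show ?thesis
    using assms(1,2) minor_eq_subst[of m \<pi> g] unfolding minion_def by metis
qed

theorem proposition5p11:
  fixes \<rho> :: "('b::finite, 'a::finite) opn set" and d :: nat
  assumes "d \<ge> 1" and "\<rho> \<subseteq> opns d"
  shows "minion (all_levels d \<rho>) \<longleftrightarrow> weak_generalized_quasiorder d \<rho>"
proof
  assume "weak_generalized_quasiorder d \<rho>"
  then have levels: "all_levels d \<rho> = (\<Union>n. instances_in d \<rho> n)"
    using level_eq_instances_in[OF assms(2)] by (simp add: all_levels_def)
  show "minion (all_levels d \<rho>)"
    unfolding minion_def levels
  proof (intro conjI ballI allI)
    show "(\<Union>n. instances_in d \<rho> n) \<subseteq> (\<Union>n. opns n)"
      by (auto simp: instances_in_def)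
    show "minor m \<pi> g \<in> (\<Union>n. instances_in d \<rho> n)"
      if "g \<in> (\<Union>n. instances_in d \<rho> n)" "\<pi> \<in> {..<fst g} \<rightarrow> {..<m}" for g m \<pi>
      using that(1) by (auto intro: minor_instances_in[OF _ that(2)])
  qed
next
  assume M: "minion (all_levels d \<rho>)"
  have level_d: "level d \<rho> d = \<rho>" and level_Suc: "level d \<rho> (Suc d) = circledast d \<rho>"
    by (simp_all add: level_def)
  have closed: "subst m w g \<in> level d \<rho> m"
    if "g \<in> level d \<rho> n" "w \<in> words n m" "set w \<subseteq> range Inl" for g n m w
  proof (rule all_levels_at_arity[OF assms(2)])
    show "subst m w g \<in> all_levels d \<rho>"
      using that level_subset_opns[OF assms(2), of n]
      by (intro minion_subst_variables[OF M]) (auto simp: all_levels_def)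
  qed simp
  \<comment> \<open>Adding a fictitious variable is a minor, and it leads from level
    \<open>d\<close> to level \<open>Suc d\<close>.\<close>
  have "eftrl g \<subseteq> circledast d \<rho>" if g: "g \<in> \<rho>" for g
  proof -
    have "subst (Suc d) w g \<in> circledast d \<rho>"
      if "w \<in> words d (Suc d)" "set w \<subseteq> range Inl" for w
      using closed[of g d w "Suc d"] g that by (simp add: level_d level_Suc)
    moreover have "set (tl (id_word (Suc d)) :: (nat + 'b) list) \<subseteq> range Inl"
      "set (id_word d :: (nat + 'b) list) \<subseteq> range Inl"
      unfolding tl_id_word by (auto simp: id_word_def)
    ultimately show ?thesis
      unfolding eftrl_eq[OF subsetD[OF assms(2) g]]
      by (simp add: tl_id_word_in_words id_word_in_words)
  qed
  \<comment> \<open>Identifying two variables is a minor, and it leads from level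
    \<open>Suc d\<close> back to level \<open>d\<close>.\<close>
  moreover have "Delta h \<subseteq> \<rho>" if h: "h \<in> circledast d \<rho>" for h
  proof -
    have "subst d (insert_at j (Inl i) (id_word d)) h \<in> \<rho>" if "i < j" "j \<le> d" for i j
    proof (subst level_d[symmetric], rule closed)
      show "h \<in> level d \<rho> (Suc d)" using h by (simp add: level_Suc)
      show "insert_at j (Inl i) (id_word d) \<in> words (Suc d) d"
        using that by (intro insert_at_in_words id_word_in_words) auto
      show "set (insert_at j (Inl i) (id_word d)) \<subseteq> range Inl"
        by (auto simp: id_word_def)
    qed
    then show ?thesis using h by (auto simp: circledast_def Delta_eq[of h d])
  qed
  ultimately show "weak_generalized_quasiorder d \<rho>"
    unfolding weak_generalized_quasiorder_def internally_reflexive_def transitive_rel_def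
      eftrl_set_def Delta_set_def by blast
qed

end
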